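(* Let $0<p<1$ and let $X$ have the logarithmic distribution with parameter $p$, whose range is the set of positive integers, with probability mass function $f(x)=-\frac{p^x}{x\ln(1-p)}$ and cumulative distribution function $F$. Define $\beta=-\frac{1}{\ln(1-p)}$. Then the first-order, complementary and second-order loss functions of $X$, as functions of $r$, are $$L_1(r)=\frac{\beta p^r}{1-p}-r\,[1-F(r-1)],$$ $$L_c(r)=r\,F(r)-\beta\left[\frac{1-p^{r+1}}{1-p}-1\right],$$ $$L_2(r)=\frac12[r^2+r]\,[1-F(r-1)]+\frac{\beta(2r+1)p^r}{2(p-1)}-\frac{\beta p^r[p(r-1)-r]}{2(1-p)^2}.$$
   Context: For a discrete random variable $X$ with probability mass function $f$ (defined on the range of $X$), the first-order loss function is $L_1(r)=\mathbb{E}[[X-r]^+]=\sum_{x\ge r}(x-r)f(x)$, the complementary loss function is $L_c(r)=\mathbb{E}[[X-r]^-]=\sum_{x\le r}(r-x)f(x)$, and the second-order loss function is $L_2(r)=\frac12\mathbb{E}[[X-r]^+[X-r-1]^+]=\frac12\sum_{x\ge r}(x-r)(x-r-1)f(x)$, the sums running over $x$ in the range of $X$. Here $[y]^+=\max(y,0)$ and $[y]^-=\max(-y,0)$. The cumulative distribution function is $F(x)=\sum_{y\le x}f(y)$, the sum running over $y$ in the range of $X$.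
   Formalization: The argument r is restricted to integers, with r ≥ 1 for L_1 and L_2 and r ≥ 0 for L_c; the printed formulas fail otherwise, e.g. L_1(0) = βp/(1−p) but the formula gives β/(1−p), and L_c(−1) = 0 but the formula gives β. *)

theory Defs
  imports "HOL-Probability.Probability"
begin

definition first_order_loss :: "'a measure \<Rightarrow> ('a \<Rightarrow> real) \<Rightarrow> real \<Rightarrow> real" where
  "first_order_loss M X r = (\<integral>\<omega>. max (X \<omega> - r) 0 \<partial>M)"

definition complementary_loss :: "'a measure \<Rightarrow> ('a \<Rightarrow> real) \<Rightarrow> real \<Rightarrow> real" where
  "complementary_loss M X r = (\<integral>\<omega>. max (- (X \<omega> - r)) 0 \<partial>M)"

definition second_order_loss :: "'a measure \<Rightarrow> ('a \<Rightarrow> real) \<Rightarrow> real \<Rightarrow> real" where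
  "second_order_loss M X r =
     1 / 2 * (\<integral>\<omega>. max (X \<omega> - r) 0 * max (X \<omega> - r - 1) 0 \<partial>M)"

definition logarithmic_pmf :: "real \<Rightarrow> nat \<Rightarrow> real" where
  "logarithmic_pmf p x = - (p ^ x / (real x * ln (1 - p)))"

text \<open>
  A density with respect to the counting measure on the positive integers is a
  probability mass function there; \<open>distributed\<close> also makes \<open>X\<close> take its values in that set.
  The coercion \<open>ennreal\<close> truncates nothing, as \<open>logarithmic_pmf p\<close> is nonnegative
  for \<open>0 < p < 1\<close>.
\<close>
definition logarithmic_distributed :: "'a measure \<Rightarrow> ('a \<Rightarrow> nat) \<Rightarrow> real \<Rightarrow> bool" where
  "logarithmic_distributed M X p \<longleftrightarrow>
     distributed M (count_space {1..}) X (\<lambda>x. ennreal (logarithmic_pmf p x))"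

end

theory Submission
  imports Defs
begin

text \<open>Since \<open>x f(x) = \<beta> p\<^sup>x\<close>, expanding the loss in powers of \<open>x\<close> leaves a multiple of
  the mass function, which sums to the distribution function, and terms \<open>\<beta> p\<^sup>x\<close> and
  \<open>\<beta> x p\<^sup>x\<close>, which sum as a geometric series and its derivative.\<close>

lemma logarithmic_pmf_nonneg:
  assumes "0 < p" "p < 1"
  shows "0 \<le> logarithmic_pmf p x"
proof -
  have "ln (1 - p) < 0" using assms by simp
  then show ?thesis
    using assms by (simp add: logarithmic_pmf_def divide_le_0_iff mult_le_0_iff)
qed

text \<open>The factor \<open>x\<close> cancels the \<open>1 / x\<close> in the mass function.
  Positivity matters: for \<open>0 < p < 1\<close> the left side vanishes at 0 while the right side
  does not.\<close>

lemma logarithmic_pmf_mult: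
  assumes "0 < x"
  shows "real x * logarithmic_pmf p x = - (1 / ln (1 - p)) * p ^ x"
  using assms by (simp add: logarithmic_pmf_def)

text \<open>The value of \<open>logarithmic_pmf p\<close> at 0 is the junk value 0, so sums over
  the positive integers may be extended to all natural numbers.\<close>

lemma logarithmic_pmf_0 [simp]: "logarithmic_pmf p 0 = 0"
  by (simp add: logarithmic_pmf_def)

text \<open>Turns an expectation into an ordinary series. Nonnegativity of \<open>g\<close> makes
  convergence of the series absolute, which is what integrability for the counting measure
  requires.\<close>

lemma logarithmic_distributed_expectation:
  fixes g :: "nat \<Rightarrow> real"
  assumes "logarithmic_distributed M X p" "0 < p" "p < 1"
    and nonneg: "\<And>x. 0 \<le> g x"
    and sums: "(\<lambda>x. logarithmic_pmf p x * g x) sums s"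
  shows "(\<integral>\<omega>. g (X \<omega>) \<partial>M) = s"
proof -
  let ?f = "\<lambda>x. logarithmic_pmf p x * g x"
  have "(\<integral>\<omega>. g (X \<omega>) \<partial>M) = (\<integral>x. ?f x \<partial>count_space {1..})"
    using assms by (intro distributed_integral[symmetric])
      (auto simp: logarithmic_distributed_def logarithmic_pmf_nonneg)
  also have "\<dots> = (\<integral>x. ?f x * indicator {1..} x \<partial>count_space UNIV)"
    using integral_restrict_space[of "{1::nat..}" "count_space UNIV" ?f]
    by (simp add: restrict_count_space mult.commute)
  also have "(\<lambda>x. ?f x * indicator {1..} x) = ?f"
  proof
    show "?f x * indicator {1..} x = ?f x" for x
      by (cases "x = 0") auto
  qed
  also have "(\<integral>x. ?f x \<partial>count_space UNIV) = (\<Sum>x. ?f x)"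
    using sums by (intro integral_count_space_nat)
      (auto simp: integrable_count_space_nat_iff nonneg logarithmic_pmf_nonneg assms sums_iff)
  also have "\<dots> = s"
    using sums by (simp add: sums_iff)
  finally show ?thesis .
qed

text \<open>The value 1 is the expectation of the constant 1 under the probability measure, so no
  logarithm series is needed. Summability must come first; it follows by comparison with a geometric
  series, as \<open>f(x) \<le> x f(x)\<close> for \<open>x \<ge> 1\<close>.\<close>

lemma logarithmic_pmf_sums_1:
  assumes "prob_space M" "logarithmic_distributed M X p" "0 < p" "p < 1"
  shows "logarithmic_pmf p sums 1"
proof -
  interpret prob_space M by fact
  have le: "norm (logarithmic_pmf p x) \<le> - (1 / ln (1 - p)) * p ^ x" for x
  proof (cases "x = 0")
    case True
    then show ?thesis using assms by (simp add: divide_nonpos_nonneg)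
  next
    case False
    then have "1 * logarithmic_pmf p x \<le> real x * logarithmic_pmf p x"
      using assms by (intro mult_right_mono logarithmic_pmf_nonneg) auto
    then show ?thesis
      using False assms by (simp add: logarithmic_pmf_mult logarithmic_pmf_nonneg)
  qed
  have "summable (\<lambda>x. - (1 / ln (1 - p)) * p ^ x)"
    using assms by (intro summable_mult summable_geometric) auto
  then have "summable (logarithmic_pmf p)"
    using le by (rule summable_comparison_test'[where N = 0])
  moreover from this have "(\<integral>\<omega>. 1 \<partial>M) = suminf (logarithmic_pmf p)"
    using assms by (intro logarithmic_distributed_expectation[where g = "\<lambda>_. 1"])
      (auto simp: summable_sums)
  ultimately show ?thesis
    by (simp add: prob_space sums_iff)
qed

text \<open>The probability of an event is the expectation of its indicator. With the argument
  \<open>real n - 1\<close>, taking \<open>n = r\<close> gives \<open>F(r - 1)\<close> and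
  \<open>n = Suc r\<close> gives \<open>F(r)\<close>.\<close>

lemma logarithmic_cdf:
  assumes "prob_space M" "logarithmic_distributed M X p" "0 < p" "p < 1"
  shows "cdf (distr M borel (\<lambda>\<omega>. real (X \<omega>))) (real n - 1) = (\<Sum>x<n. logarithmic_pmf p x)"
proof -
  interpret prob_space M by fact
  have "X \<in> measurable M (count_space {1..})"
    using assms by (auto simp: logarithmic_distributed_def dest: distributed_measurable)
  from measurable_compose[OF this, of real borel]
  have X: "(\<lambda>\<omega>. real (X \<omega>)) \<in> borel_measurable M" by simp
  have "cdf (distr M borel (\<lambda>\<omega>. real (X \<omega>))) (real n - 1)
      = measure M ((\<lambda>\<omega>. real (X \<omega>)) -` {..real n - 1} \<inter> space M)"
    using X by (simp add: cdf_def measure_distr)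
  also have "(\<lambda>\<omega>. real (X \<omega>)) -` {..real n - 1} \<inter> space M = X -` {..<n} \<inter> space M"
    by auto
  also have "measure M \<dots> = (\<integral>\<omega>. indicator (X -` {..<n} \<inter> space M) \<omega> \<partial>M)"
    by simp
  also have "\<dots> = (\<integral>\<omega>. indicator {..<n} (X \<omega>) \<partial>M)"
    by (intro Bochner_Integration.integral_cong) (auto simp: indicator_def)
  also have "\<dots> = (\<Sum>x<n. logarithmic_pmf p x)"
  proof (intro logarithmic_distributed_expectation[OF assms(2-4)])
    show "(\<lambda>x. logarithmic_pmf p x * indicator {..<n} x) sums (\<Sum>x<n. logarithmic_pmf p x)"
      using sums_finite[of "{..<n}" "\<lambda>x. logarithmic_pmf p x * indicator {..<n} x"] by simp
  qed simp
  finally show ?thesis .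
qed

lemma logarithmic_pmf_tail_sums:
  assumes "prob_space M" "logarithmic_distributed M X p" "0 < p" "p < 1"
  shows "(\<lambda>x. logarithmic_pmf p (x + n)) sums
           (1 - cdf (distr M borel (\<lambda>\<omega>. real (X \<omega>))) (real n - 1))"
  using sums_split_initial_segment[OF logarithmic_pmf_sums_1[OF assms], of n]
  by (simp add: logarithmic_cdf[OF assms])

text \<open>Starting the series at the threshold \<open>n\<close> removes the truncation by
  \<open>max\<close> from the summands of the first-order and second-order losses.\<close>

lemma logarithmic_distributed_expectation_tail:
  fixes g :: "nat \<Rightarrow> real"
  assumes "logarithmic_distributed M X p" "0 < p" "p < 1"
    and "\<And>x. 0 \<le> g x"
    and zero: "\<And>x. x < n \<Longrightarrow> g x = 0"
    and sums: "(\<lambda>x. logarithmic_pmf p (x + n) * g (x + n)) sums s"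
  shows "(\<integral>\<omega>. g (X \<omega>) \<partial>M) = s"
proof (rule logarithmic_distributed_expectation[OF assms(1-4)])
  show "(\<lambda>x. logarithmic_pmf p x * g x) sums s"
    using sums zero by (subst (asm) sums_zero_iff_shift) auto
qed

theorem mainTheorem3:
  fixes M :: "'a measure" and X :: "'a \<Rightarrow> nat" and p \<beta> :: real
    and F :: "real \<Rightarrow> real" and r :: nat
  assumes "prob_space M"
    and "0 < p" and "p < 1"
    and "logarithmic_distributed M X p"
    and "F = cdf (distr M borel (\<lambda>\<omega>. real (X \<omega>)))"
    and "\<beta> = - (1 / ln (1 - p))"
  shows "(1 \<le> r \<longrightarrow>
            first_order_loss M (\<lambda>\<omega>. real (X \<omega>)) (real r) =
              \<beta> * p ^ r / (1 - p) - real r * (1 - F (real r - 1)))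
       \<and> complementary_loss M (\<lambda>\<omega>. real (X \<omega>)) (real r) =
           real r * F (real r) - \<beta> * ((1 - p ^ (r + 1)) / (1 - p) - 1)
       \<and> (1 \<le> r \<longrightarrow>
            second_order_loss M (\<lambda>\<omega>. real (X \<omega>)) (real r) =
              1 / 2 * ((real r)\<^sup>2 + real r) * (1 - F (real r - 1))
              + \<beta> * (2 * real r + 1) * p ^ r / (2 * (p - 1))
              - \<beta> * p ^ r * (p * (real r - 1) - real r) / (2 * (1 - p)\<^sup>2))"
proof (intro conjI impI)
  let ?f = "logarithmic_pmf p"
  have pmf_mult: "real x * ?f x = \<beta> * p ^ x" if "0 < x" for x
    using logarithmic_pmf_mult[OF that] assms(6) by simp
  have tail: "(\<lambda>x. ?f (x + r)) sums (1 - F (real r - 1))"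
    using logarithmic_pmf_tail_sums[of M X p r] assms by simp
  have geom: "(\<lambda>x. p ^ x) sums (1 / (1 - p))"
    using assms by (intro geometric_sums) auto
  note expect = logarithmic_distributed_expectation_tail[OF assms(4,2,3), where n = r]

  show "first_order_loss M (\<lambda>\<omega>. real (X \<omega>)) (real r) =
          \<beta> * p ^ r / (1 - p) - real r * (1 - F (real r - 1))"
    if "1 \<le> r"
    unfolding first_order_loss_def
  proof (rule expect[where g = "\<lambda>x. max (real x - real r) 0"])
    \<comment> \<open>Here \<open>1 \<le> r\<close> keeps \<open>x + r\<close> positive even at
      \<open>x = 0\<close>, as \<open>pmf_mult\<close> requires.\<close>
    have "?f (x + r) * max (real (x + r) - real r) 0
        = \<beta> * p ^ r * p ^ x - real r * ?f (x + r)" for x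
      using pmf_mult[of "x + r"] that by (simp add: algebra_simps power_add)
    then show "(\<lambda>x. ?f (x + r) * max (real (x + r) - real r) 0) sums
        (\<beta> * p ^ r / (1 - p) - real r * (1 - F (real r - 1)))"
      using sums_diff[OF sums_mult[OF geom, of "\<beta> * p ^ r"] sums_mult[OF tail, of "real r"]]
      by simp
  qed auto

  show "complementary_loss M (\<lambda>\<omega>. real (X \<omega>)) (real r) =
          real r * F (real r) - \<beta> * ((1 - p ^ (r + 1)) / (1 - p) - 1)"
    unfolding complementary_loss_def
  proof (rule logarithmic_distributed_expectation[OF assms(4,2,3),
        where g = "\<lambda>x. max (- (real x - real r)) 0"])
    let ?g = "\<lambda>x. ?f x * max (- (real x - real r)) 0"
    \<comment> \<open>The term at 0 is zero and is split off before \<open>pmf_mult\<close> applies.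
      Completing the geometric sum with \<open>p ^ 0\<close> then produces the \<open>- 1\<close> of
      the formula.\<close>
    have "(\<Sum>x<Suc r. real x * ?f x) = (\<Sum>x<r. \<beta> * p ^ Suc x)"
      unfolding sum.lessThan_Suc_shift by (simp add: pmf_mult del: of_nat_Suc)
    also have "\<dots> = \<beta> * ((\<Sum>x<Suc r. p ^ x) - 1)"
      unfolding sum.lessThan_Suc_shift by (simp add: sum_distrib_left)
    also have "(\<Sum>x<Suc r. p ^ x) = (1 - p ^ (r + 1)) / (1 - p)"
      using assms by (subst sum_gp_strict) auto
    finally have mean: "(\<Sum>x<Suc r. real x * ?f x) = \<beta> * ((1 - p ^ (r + 1)) / (1 - p) - 1)" .
    have "(\<Sum>x<Suc r. ?g x) = (\<Sum>x<Suc r. real r * ?f x - real x * ?f x)"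
      by (intro sum.cong) (auto simp: algebra_simps)
    also have "\<dots> = real r * (\<Sum>x<Suc r. ?f x) - (\<Sum>x<Suc r. real x * ?f x)"
      by (simp only: sum_subtractf sum_distrib_left)
    also have "(\<Sum>x<Suc r. ?f x) = F (real r)"
      using logarithmic_cdf[of M X p "Suc r"] assms by simp
    finally have "(\<Sum>x<Suc r. ?g x) = real r * F (real r) - \<beta> * ((1 - p ^ (r + 1)) / (1 - p) - 1)"
      unfolding mean .
    moreover have "?g sums (\<Sum>x<Suc r. ?g x)"
      by (intro sums_finite) auto
    ultimately show "?g sums (real r * F (real r) - \<beta> * ((1 - p ^ (r + 1)) / (1 - p) - 1))"
      by simp
  qed auto

  show "second_order_loss M (\<lambda>\<omega>. real (X \<omega>)) (real r) =
          1 / 2 * ((real r)\<^sup>2 + real r) * (1 - F (real r - 1))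
          + \<beta> * (2 * real r + 1) * p ^ r / (2 * (p - 1))
          - \<beta> * p ^ r * (p * (real r - 1) - real r) / (2 * (1 - p)\<^sup>2)"
    if "1 \<le> r"
  proof -
    let ?g = "\<lambda>x. max (real x - real r) 0 * max (real x - real r - 1) 0"
    \<comment> \<open>Twice the loss. The last factor sums \<open>(x - r - 1) p^x\<close>, split as
      \<open>(x + 1) p^x - (r + 2) p^x\<close> to match the derivative of the geometric
      series.\<close>
    let ?s = "((real r)\<^sup>2 + real r) * (1 - F (real r - 1))
        + \<beta> * p ^ r * (1 / (1 - p)\<^sup>2 - (real r + 2) * (1 / (1 - p)))"
    have "(\<integral>\<omega>. ?g (X \<omega>) \<partial>M) = ?s"
    proof (rule expect[where g = ?g])
      have "?f (x + r) * ?g (x + r) = ((real r)\<^sup>2 + real r) * ?f (x + r)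
          + \<beta> * p ^ r * (real (Suc x) * p ^ x - (real r + 2) * p ^ x)" for x
      proof -
        \<comment> \<open>At \<open>x = 0\<close> the second \<open>max\<close> does truncate, but
          the factor \<open>x\<close> is zero there.\<close>
        have "?g (x + r) = real x * (real x - 1)"
          by (cases x) auto
        \<comment> \<open>Division with remainder by \<open>x + r\<close>: the remainder multiplies
          the mass function, and the factor \<open>x + r\<close> cancels its denominator.\<close>
        also have "\<dots> = (real r)\<^sup>2 + real r + (real x - real r - 1) * real (x + r)"
          by (simp add: algebra_simps power2_eq_square)
        also have "?f (x + r) * \<dots> = ((real r)\<^sup>2 + real r) * ?f (x + r)
            + (real x - real r - 1) * (real (x + r) * ?f (x + r))"
          by (simp add: algebra_simps)
        also have "real (x + r) * ?f (x + r) = \<beta> * p ^ (x + r)"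
          using that by (intro pmf_mult) simp
        finally show ?thesis
          by (simp add: algebra_simps power_add)
      qed
      moreover have "(\<lambda>x. real (Suc x) * p ^ x) sums (1 / (1 - p)\<^sup>2)"
        using assms by (intro geometric_deriv_sums) auto
      ultimately show "(\<lambda>x. ?f (x + r) * ?g (x + r)) sums ?s"
        by (simp only:) (intro sums_add sums_diff sums_mult tail geom)
    qed auto
    moreover have "\<beta> * p ^ r * (1 / (1 - p)\<^sup>2 - (real r + 2) * (1 / (1 - p)))
        = 2 * (\<beta> * (2 * real r + 1) * p ^ r / (2 * (p - 1))
          - \<beta> * p ^ r * (p * (real r - 1) - real r) / (2 * (1 - p)\<^sup>2))"
    proof -
      have "p - 1 = - (1 - p)" "1 - p \<noteq> 0" using assms by auto
      then show ?thesis
        by (simp add: divide_simps power2_eq_square) (simp add: algebra_simps)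
    qed
    ultimately show ?thesis
      unfolding second_order_loss_def by simp
  qed
qed

end
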